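(* Let $f_1,\dots,f_n:\mathbb{R}^p\to\mathbb{R}$ be convex and differentiable. Assume that each $\nabla f_i$ is Lipschitz continuous with Lipschitz modulus $L_i$, put $L=\max_i L_i$, and assume that $\bar f=\sum_{i=1}^n f_i$ is strongly convex with constant $\mu_{\bar f}>0$. Let $\rho>0$, $\eta\in(0,1)$, and $\mathbf{P}\succeq\mathbf{0}$. Let $\{(\mathbf{x}^k,\boldsymbol{\alpha}^k)\}_{k\ge 0}$ be the iterates of generalized D-ADMM, initialized so that $\boldsymbol{\alpha}^0$ lies in the column space of $\mathbf{E}_{\mathrm{o}}$ (with $\boldsymbol{\lambda}^0=[\boldsymbol{\alpha}^0;-\boldsymbol{\alpha}^0]$ and $\mathbf{z}^0=\tfrac12\mathbf{E}_{\mathrm{u}}\mathbf{x}^0$ for the eliminated variables), and let $\mathbf{u}^k=[\boldsymbol{\alpha}^k;\mathbf{x}^k]$, $\mathbf{u}^\star=[\boldsymbol{\alpha}^\star;\mathbf{x}^\star]$. Then for all $k\ge 0$ $$\|\mathbf{u}^{k+1}-\mathbf{u}^\star\|_{\mathbf{H}}^2\le\frac{1}{1+\delta}\,\|\mathbf{u}^k-\mathbf{u}^\star\|_{\mathbf{H}}^2,$$ where $\delta$ is any strictly positive number fulfilling $$\delta\le\max_{\tau>0}\min\left\{\frac{\rho\eta\,\tilde\lambda_{\min}(\mathbf{E}_{\mathrm{o}}^T\mathbf{E}_{\mathrm{o}})}{2(1+1/\tau)\lambda_{\max}(\mathbf{M})},\ \frac{\rho\eta\,\mu_g\,\tilde\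lambda_{\min}(\mathbf{E}_{\mathrm{o}}^T\mathbf{E}_{\mathrm{o}})}{(1+\tau)L_g^2+\rho\eta\,\lambda_{\max}(\mathbf{M})\,\tilde\lambda_{\min}(\mathbf{E}_{\mathrm{o}}^T\mathbf{E}_{\mathrm{o}})}\right\}.$$
   Context: Network. $\mathcal{G}=\{\mathcal{V},\mathcal{A}\}$ is a connected network with $n=|\mathcal{V}|\ge 2$ agents and $m=|\mathcal{A}|$ arcs (directed edges, no self-loops), bidirectional: $(i,j)\in\mathcal{A}$ iff $(j,i)\in\mathcal{A}$. Arcs are labelled $1,\dots,m$. $\mathbf{A}_{\mathrm{s}}\in\mathbb{R}^{mp\times np}$ is the block arc source matrix: its $p\times p$ block $(a,i)$ is $\mathbf{I}_p$ if arc $a$ originates from node $i$ and $\mathbf{0}_p$ otherwise. $\mathbf{A}_{\mathrm{d}}$ is defined analogously with arc destinations. $\mathbf{E}_{\mathrm{o}}=\mathbf{A}_{\mathrm{s}}-\mathbf{A}_{\mathrm{d}}$, $\mathbf{E}_{\mathrm{u}}=\mathbf{A}_{\mathrm{s}}+\mathbf{A}_{\mathrm{d}}$, and $\mathbf{D}=\tfrac12(\mathbf{E}_{\mathrm{o}}^T\mathbf{E}_{\mathrm{o}}+\mathbf{E}_{\mathrm{u}}^T\mathbf{E}_{\mathrm{u}})$, which is diagonal. Problem. $\mathbf{x}=[\mathbf{x}_1;\dots;\mathbf{x}_n]\in\mathbb{R}^{np}$ and $f(\mathbf{x})=\sum_{i=1}^n f_i(\mathbf{x}_i)$. The problem $\min_{\bar{\mathbf{x}}\in\mathbb{R}^p}\bar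 f(\bar{\mathbf{x}})$ is reformulated as $\min_{\mathbf{x},\mathbf{z}} f(\mathbf{x})$ subject to $\mathbf{A}_{\mathrm{s}}\mathbf{x}=\mathbf{z}$, $\mathbf{A}_{\mathrm{d}}\mathbf{x}=\mathbf{z}$, $\mathbf{z}\in\mathbb{R}^{mp}$, with multiplier $\boldsymbol{\lambda}=[\boldsymbol{\alpha};\boldsymbol{\beta}]$, where $\boldsymbol{\alpha},\boldsymbol{\beta}\in\mathbb{R}^{mp}$ correspond to the first and second constraint respectively. $\mathbf{x}^\star=[\bar{\mathbf{x}}^\star;\dots;\bar{\mathbf{x}}^\star]$ with $\bar{\mathbf{x}}^\star$ the minimizer of $\bar f$, and $\boldsymbol{\alpha}^\star$ is the unique vector in the column space of $\mathbf{E}_{\mathrm{o}}$ such that $[\boldsymbol{\alpha}^\star;-\boldsymbol{\alpha}^\star]$ is an optimal multiplier, i.e. such that $\nabla f(\mathbf{x}^\star)+\mathbf{E}_{\mathrm{o}}^T\boldsymbol{\alpha}^\star=\mathbf{0}$. Algorithm (generalized D-ADMM). $\mathbf{P}=\boldsymbol{\Pi}\otimes\mathbf{I}_p$ with $\boldsymbol{\Pi}\in\mathbb{R}^{n\times n}$ diagonal. For $k\ge 0$, $$\mathbf{x}^{k+1}=\arg\min_{\mathbf{x}\in\mathbb{R}^{np}}\ f(\mathbf{x})+\Big(\mathbf{E}_{\mathrm{o}}^T\boldsymbol{\alpha}^k-\tfrac{\rho}{2}\mathbf{E}_{\mathrm{u}}^T\mathbf{E}_{\mathrm{u}}\mathbf{x}^k\Big)^T\mathbf{x}+\tfrac{\rho}{2}\|\mathbf{x}\|_{\mathbf{D}}^2+\tfrac12\|\mathbf{x}-\mathbf{x}^k\|_{\mathbf{P}}^2,$$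 $$\boldsymbol{\alpha}^{k+1}=\boldsymbol{\alpha}^k+\tfrac{\eta\rho}{2}\mathbf{E}_{\mathrm{o}}\mathbf{x}^{k+1}.$$ (This decouples across the nodes when expressed through $\boldsymbol{\phi}^k=\mathbf{E}_{\mathrm{o}}^T\boldsymbol{\alpha}^k$. The variables $\mathbf{z}$ and $\boldsymbol{\lambda}$ do not appear in these iterates.) Constants and norms. $\|\mathbf{v}\|_{\mathbf{S}}^2=\mathbf{v}^T\mathbf{S}\mathbf{v}$ for $\mathbf{S}\succeq\mathbf{0}$ (possibly only a semi-norm). $\mathbf{M}=\tfrac{\rho}{2}\big(2\mathbf{D}+\tfrac{2}{\rho}\mathbf{P}-\mathbf{E}_{\mathrm{o}}^T\mathbf{E}_{\mathrm{o}}\big)$ and $\mathbf{H}=\begin{pmatrix}\tfrac{2}{\rho\eta}\mathbf{I}_{mp}&\mathbf{0}\\ \mathbf{0}&\mathbf{M}\end{pmatrix}$. $\lambda_{\max}(\cdot)$ is the largest eigenvalue and $\tilde\lambda_{\min}(\cdot)$ the smallest non-zero eigenvalue. Let $g(\mathbf{x})=f(\mathbf{x})+\tfrac{\rho(1-\eta)}{4}\|\mathbf{E}_{\mathrm{o}}\mathbf{x}\|^2$. $L_g=L+(1-\eta)\tfrac{\rho}{2}\lambda_{\max}(\mathbf{E}_{\mathrm{o}}^T\mathbf{E}_{\mathrm{o}})$, which is a Lipschitz modulus of $\nabla g$. $\mu_g>0$ denotes a restricted strong convexity constant of $g$ with respect to $\mathbf{x}^\star$, i.e. $(\nabla g(\mathbf{x})-\nabla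 g(\mathbf{x}^\star))^T(\mathbf{x}-\mathbf{x}^\star)\ge\mu_g\|\mathbf{x}-\mathbf{x}^\star\|^2$ for all $\mathbf{x}\in\mathbb{R}^{np}$. Under the assumptions of the claim such a constant exists; for any $\gamma\in(0,\tfrac{\mu_{\bar f}/n}{2L})$ one may take $\min\big\{\tfrac{\mu_{\bar f}}{n}-2L\gamma,\ \tfrac{\tilde\lambda_{\min}(\mathbf{E}_{\mathrm{o}}^T\mathbf{E}_{\mathrm{o}})\rho(1-\eta)}{2(1+1/\gamma^2)}\big\}$. *)

theory Defs
  imports "HOL-Analysis.Analysis"
begin

definition grad :: "('a::real_inner \<Rightarrow> real) \<Rightarrow> 'a \<Rightarrow> 'a" where
  "grad f x = (THE d. GDERIV f x :> d)"

definition strongly_convex_with :: "real \<Rightarrow> ('a::real_normed_vector \<Rightarrow> real) \<Rightarrow> bool" where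
  "strongly_convex_with \<mu> f \<longleftrightarrow>
     (\<forall>x y. \<forall>t\<in>{0..1}. f ((1 - t) *\<^sub>R x + t *\<^sub>R y)
        \<le> (1 - t) * f x + t * f y - \<mu> / 2 * t * (1 - t) * (norm (x - y))\<^sup>2)"

definition restricted_strongly_convex_with ::
    "real \<Rightarrow> ('a::real_inner \<Rightarrow> real) \<Rightarrow> 'a \<Rightarrow> bool" where
  "restricted_strongly_convex_with \<mu> g c \<longleftrightarrow>
     (\<forall>x. inner (grad g x - grad g c) (x - c) \<ge> \<mu> * (norm (x - c))\<^sup>2)"

definition diagonal_matrix :: "real^'n^'n \<Rightarrow> bool" where
  "diagonal_matrix S \<longleftrightarrow> (\<forall>i j. i \<noteq> j \<longrightarrow> S $ i $ j = 0)"

definition pos_semidef :: "real^'n^'n \<Rightarrow> bool" where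
  "pos_semidef S \<longleftrightarrow> transpose S = S \<and> (\<forall>v. 0 \<le> inner v (S *v v))"

definition sqnorm :: "real^'n^'n \<Rightarrow> real^'n \<Rightarrow> real" where
  "sqnorm S v = inner v (S *v v)"

text \<open>
  The set of real eigenvalues is finite, but possibly empty for a non-symmetric matrix;
  the extremal eigenvalues below are only meaningful for symmetric matrices, and
  \<open>lambda_min_nz\<close> only for non-zero ones.
\<close>

definition eigenvalues :: "real^'n^'n \<Rightarrow> real set" where
  "eigenvalues S = {c. \<exists>v. v \<noteq> 0 \<and> S *v v = c *\<^sub>R v}"

definition lambda_max :: "real^'n^'n \<Rightarrow> real" where
  "lambda_max S = Max (eigenvalues S)"

definition lambda_min_nz :: "real^'n^'n \<Rightarrow> real" where
  "lambda_min_nz S = Min (eigenvalues S - {0})"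

text \<open>
  A vector made of blocks of size \<open>'p\<close>, one for each element of \<open>'n\<close>, is indexed by
  \<open>'n \<times> 'p\<close>; vertical concatenation of two vectors is indexed by a sum type.
\<close>

definition kronecker :: "real^'b^'a \<Rightarrow> real^'d^'c \<Rightarrow>
    real^('b::finite \<times> 'd::finite)^('a::finite \<times> 'c::finite)" where
  "kronecker A B = (\<chi> r s. A $ fst r $ fst s * B $ snd r $ snd s)"

definition block :: "real^('n::finite \<times> 'p::finite) \<Rightarrow> 'n \<Rightarrow> real^'p" where
  "block x i = (\<chi> c. x $ (i, c))"

definition consensus :: "real^'p \<Rightarrow> real^('n::finite \<times> 'p::finite)" where
  "consensus v = (\<chi> r. v $ snd r)"

definition stack :: "real^'a \<Rightarrow> real^'b \<Rightarrow> real^('a::finite + 'b::finite)" where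
  "stack a b = (\<chi> r. case r of Inl i \<Rightarrow> a $ i | Inr j \<Rightarrow> b $ j)"

definition block_diag :: "real^'a^'a \<Rightarrow> real^'b^'b \<Rightarrow>
    real^('a::finite + 'b::finite)^('a + 'b)" where
  "block_diag A B = (\<chi> r s.
     case (r, s) of
       (Inl i, Inl j) \<Rightarrow> A $ i $ j
     | (Inr i, Inr j) \<Rightarrow> B $ i $ j
     | _ \<Rightarrow> 0)"

definition connected_network :: "('n \<times> 'n) set \<Rightarrow> bool" where
  "connected_network \<A> \<longleftrightarrow> irrefl \<A> \<and> sym \<A> \<and> (\<forall>i j. (i, j) \<in> \<A>\<^sup>*)"

text \<open>
  The arcs are labelled by the elements of \<open>'m\<close>: \<open>lab a\<close> is the pair (source, destination)
  of the arc with label \<open>a\<close>.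
\<close>

definition arc_source_matrix ::
    "('m \<Rightarrow> 'n \<times> 'n) \<Rightarrow> real^('n::finite \<times> 'p::finite)^('m::finite \<times> 'p)" where
  "arc_source_matrix lab = (\<chi> r s. if fst (lab (fst r)) = fst s \<and> snd r = snd s then 1 else 0)"

definition arc_destination_matrix ::
    "('m \<Rightarrow> 'n \<times> 'n) \<Rightarrow> real^('n::finite \<times> 'p::finite)^('m::finite \<times> 'p)" where
  "arc_destination_matrix lab =
     (\<chi> r s. if snd (lab (fst r)) = fst s \<and> snd r = snd s then 1 else 0)"

end

theory Submission
  imports Defs
begin

text \<open>
  By the definition of \<open>D\<close>, \<open>M = (\<rho>/2) E\<^sub>u\<^sup>T E\<^sub>u + P\<close>. Hence \<open>M\<close> is positive semidefinite, and it
  collects the terms of the primal update that depend only on the difference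
  \<open>x\<^bsub>k+1\<^esub> - x\<^bsub>k\<^esub>\<close>. The optimality condition of the primal update is therefore
  \<open>\<nabla>f(x\<^bsub>k+1\<^esub>) + E\<^sub>o\<^sup>T \<alpha>\<^bsub>k\<^esub> + (\<rho>/2) E\<^sub>o\<^sup>T E\<^sub>o x\<^bsub>k+1\<^esub> + M (x\<^bsub>k+1\<^esub> - x\<^bsub>k\<^esub>) = 0\<close>.
  Expressing \<open>\<alpha>\<^bsub>k\<^esub>\<close> by \<open>\<alpha>\<^bsub>k+1\<^esub>\<close> absorbs only the fraction \<open>\<eta>\<close> of the penalty term; the remaining
  fraction turns \<open>f\<close> into \<open>g\<close>. Subtracting the condition at the optimum, where
  \<open>E\<^sub>o x\<^sup>\<star> = 0\<close> makes the gradients of \<open>f\<close> and \<open>g\<close> agree, gives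
  \<open>\<nabla>g(x\<^bsub>k+1\<^esub>) - \<nabla>g(x\<^sup>\<star>) + E\<^sub>o\<^sup>T (\<alpha>\<^bsub>k+1\<^esub> - \<alpha>\<^sup>\<star>) + M (x\<^bsub>k+1\<^esub> - x\<^bsub>k\<^esub>) = 0\<close>.

  The rest is the contraction argument of \<open>proximal_primal_dual_contraction\<close>. Pairing this equation
  with \<open>x\<^bsub>k+1\<^esub> - x\<^sup>\<star>\<close> shows that one step decreases the squared \<open>H\<close>-distance to the optimum by
  the squared \<open>H\<close>-length of the step plus
  \<open>2 \<langle>\<nabla>g(x\<^bsub>k+1\<^esub>) - \<nabla>g(x\<^sup>\<star>), x\<^bsub>k+1\<^esub> - x\<^sup>\<star>\<rangle>\<close>. It remains to bound \<open>\<delta>\<close> times the new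
  distance by this decrease. The primal error is controlled by restricted strong convexity. The dual
  error lies in the column space of \<open>E\<^sub>o\<close>, where the norm of its image under \<open>E\<^sub>o\<^sup>T\<close> controls it
  (\<open>lambda_min_nz_le_on_column_space\<close>); the equation expresses this image by the gradient
  difference and \<open>M (x\<^bsub>k+1\<^esub> - x\<^bsub>k\<^esub>)\<close>, and \<open>\<tau>\<close> is the weight of Young's inequality that
  separates the two.

  The bounds by extremal eigenvalues rest on one fact: on an invariant subspace, a minimizer of the
  Rayleigh quotient of a symmetric operator is an eigenvector
  (\<open>Rayleigh_minimizer_is_eigenvector\<close>). Finally, every \<open>\<epsilon> < \<delta>\<close> lies below the
  rate of some \<open>\<tau>\<close>, so the contraction holds for \<open>\<epsilon>\<close>; the bound for \<open>\<delta>\<close> itself follows in the limit.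
\<close>

section \<open>Extremal eigenvalues of symmetric matrices\<close>

text \<open>
  The quadratic polynomial \<open>t \<mapsto> \<langle>T (v + t w), v + t w\<rangle>\<close> is nonnegative, so its discriminant is
  not positive. The form may be degenerate, hence the separate case of a vanishing leading
  coefficient.
\<close>

lemma psd_Cauchy_Schwarz:
  fixes T :: "'a::real_inner \<Rightarrow> 'a"
  assumes T: "linear T" and S: "subspace S"
    and sym: "\<And>v w. v \<in> S \<Longrightarrow> w \<in> S \<Longrightarrow> inner (T v) w = inner v (T w)"
    and psd: "\<And>v. v \<in> S \<Longrightarrow> 0 \<le> inner (T v) v"
    and v: "v \<in> S" and w: "w \<in> S"
  shows "(inner (T v) w)\<^sup>2 \<le> inner (T v) v * inner (T w) w"
proof -
  define a b c where "a = inner (T v) v" and "b = inner (T v) w" and "c = inner (T w) w"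
  have quadratic: "0 \<le> a + 2 * t * b + t\<^sup>2 * c" for t
  proof -
    have "v + t *\<^sub>R w \<in> S"
      using v w S by (simp add: subspace_add subspace_scale)
    moreover have "inner (T w) v = b"
      using sym[OF v w] by (simp add: b_def inner_commute)
    ultimately show ?thesis
      using psd[of "v + t *\<^sub>R w"]
      by (simp add: linear_add[OF T] linear_scale[OF T]
          a_def b_def c_def power2_eq_square algebra_simps)
  qed
  have "b\<^sup>2 \<le> a * c"
  proof (cases "c = 0")
    case True
    \<comment> \<open>A non-constant affine function takes negative values; this argument is chosen to give \<open>- 1\<close>.\<close>
    have "b = 0"
      using quadratic[of "- (a + 1) / (2 * b)"] True by (cases "b = 0") (auto simp: field_simps)
    then show ?thesis using True by simp
  next
    case False
    then have "c > 0" using psd[OF w] by (simp add: c_def)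
    then show ?thesis
      using quadratic[of "- b / c"] by (simp add: power2_eq_square field_simps)
  qed
  then show ?thesis by (simp add: a_def b_def c_def)
qed

text \<open>
  The Rayleigh quotient attains its minimum \<open>c\<close> on the compact unit sphere of \<open>S\<close>. This is the source
  of eigenvalues for both ends of the spectrum: for the upper end it is applied to \<open>- S\<close> with a symmetric
  matrix \<open>S\<close> on the whole space, for the lower end to \<open>A A\<^sup>T\<close> on the column space of \<open>A\<close>.
\<close>

lemma Rayleigh_minimizer_is_eigenvector:
  fixes T :: "'a::euclidean_space \<Rightarrow> 'a"
  assumes T: "linear T" and S: "subspace S" and inv: "\<And>v. v \<in> S \<Longrightarrow> T v \<in> S"
    and sym: "\<And>v w. v \<in> S \<Longrightarrow> w \<in> S \<Longrightarrow> inner (T v) w = inner v (T w)"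
    and nontrivial: "z \<in> S" "z \<noteq> 0"
  obtains c v where "v \<in> S" "v \<noteq> 0" "T v = c *\<^sub>R v"
    "\<And>w. w \<in> S \<Longrightarrow> c * (norm w)\<^sup>2 \<le> inner (T w) w"
proof -
  let ?K = "S \<inter> sphere 0 1"
  have "compact ?K"
    using S by (intro closed_Int_compact closed_subspace compact_sphere)
  moreover have "z /\<^sub>R norm z \<in> ?K"
    using nontrivial S by (simp add: subspace_scale)
  moreover have "continuous_on ?K (\<lambda>v. inner (T v) v)"
    by (intro continuous_intros linear_continuous_on linear_conv_bounded_linear[THEN iffD1] T)
  ultimately obtain v where v: "v \<in> ?K" and vmin: "\<forall>w\<in>?K. inner (T v) v \<le> inner (T w) w"
    using continuous_attains_inf[of ?K "\<lambda>v. inner (T v) v"] by blast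
  define c where "c = inner (T v) v"
  have bound: "c * (norm w)\<^sup>2 \<le> inner (T w) w" if "w \<in> S" for w
  proof (cases "w = 0")
    case False
    then have "w /\<^sub>R norm w \<in> ?K" using that S by (simp add: subspace_scale)
    then have "c \<le> inner (T (w /\<^sub>R norm w)) (w /\<^sub>R norm w)"
      using vmin by (simp only: c_def)
    also have "\<dots> = inner (T w) w / (norm w)\<^sup>2"
      by (simp add: linear_scale[OF T] power2_eq_square divide_simps)
    finally show ?thesis using False by (simp add: field_simps)
  qed simp
  \<comment> \<open>The form of \<open>T - c\<close> is semidefinite on \<open>S\<close> and vanishes at \<open>v\<close>, so \<open>v\<close> is in its kernel.\<close>
  let ?R = "\<lambda>w. T w - c *\<^sub>R w"
  have vS: "v \<in> S" and nv: "norm v = 1" using v by auto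
  have RvS: "?R v \<in> S" using vS S inv by (simp add: subspace_diff subspace_scale)
  have "(inner (?R v) (?R v))\<^sup>2 \<le> inner (?R v) v * inner (?R (?R v)) (?R v)"
  proof (rule psd_Cauchy_Schwarz[where T = ?R, OF _ S _ _ vS RvS])
    show "linear ?R"
      using T by (intro linear_compose_sub linear_compose_scale_right linear_ident)
    show "inner (?R v) w = inner v (?R w)" if "v \<in> S" "w \<in> S" for v w
      using sym[OF that] by (simp add: inner_diff_left inner_diff_right)
    show "0 \<le> inner (?R v) v" if "v \<in> S" for v
      using bound[OF that] by (simp add: inner_diff_left power2_norm_eq_inner)
  qed
  moreover have "inner (?R v) v = 0"
    using nv by (simp add: inner_diff_left c_def flip: power2_norm_eq_inner)
  ultimately have "T v = c *\<^sub>R v" by simp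
  moreover have "v \<noteq> 0" using nv by auto
  ultimately show thesis using that vS bound by blast
qed

lemma inner_matrix_adjoint:
  fixes A :: "real^'n^'m"
  shows "inner (A *v v) w = inner v (transpose A *v w)"
  by (metis dot_lmul_matrix inner_commute transpose_matrix_vector)

lemma inner_gram:
  fixes A :: "real^'n^'m"
  shows "inner ((transpose A ** A) *v v) v = (norm (A *v v))\<^sup>2"
  by (simp only: inner_matrix_adjoint[of "transpose A"] transpose_transpose
      matrix_vector_mul_assoc[symmetric] power2_norm_eq_inner)

lemma pos_semidef_gram: "pos_semidef (transpose A ** A)"
  for A :: "real^'n^'m"
  unfolding pos_semidef_def
  by (simp add: matrix_transpose_mul inner_commute[of _ "(transpose A ** A) *v _"] inner_gram
      del: transpose_matrix_vector)

text \<open>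
  Eigenvectors of distinct eigenvalues are orthogonal, hence independent. Finiteness is what makes
  \<open>Max\<close> and \<open>Min\<close> in the definitions of the extremal eigenvalues meaningful.
\<close>

lemma finite_eigenvalues:
  fixes S :: "real^'n^'n"
  assumes "transpose S = S"
  shows "finite (eigenvalues S)"
proof -
  define e where "e c = (SOME v. v \<noteq> 0 \<and> S *v v = c *\<^sub>R v)" for c
  have e: "e c \<noteq> 0 \<and> S *v e c = c *\<^sub>R e c" if "c \<in> eigenvalues S" for c
    using someI_ex[of "\<lambda>v. v \<noteq> 0 \<and> S *v v = c *\<^sub>R v"] that
    unfolding e_def eigenvalues_def by blast
  have orth: "orthogonal (e c) (e d)"
    if "c \<in> eigenvalues S" "d \<in> eigenvalues S" "c \<noteq> d" for c d
  proof -
    have "c * inner (e c) (e d) = d * inner (e c) (e d)"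
      using e[OF that(1)] e[OF that(2)] inner_matrix_adjoint[of S "e c" "e d"] assms by simp
    then show ?thesis using that by (simp add: orthogonal_def)
  qed
  have "inj_on e (eigenvalues S)"
    using orth e by (metis inj_onI orthogonal_self)
  moreover have "independent (e ` eigenvalues S)"
    using orth e by (intro pairwise_orthogonal_independent) (auto simp: pairwise_def)
  ultimately show ?thesis
    using finiteI_independent finite_imageD by blast
qed

text \<open>
  A minimizer of the Rayleigh quotient of \<open>- S\<close> yields an eigenvalue of \<open>S\<close> that bounds the quadratic
  form from above, and no eigenvalue exceeds \<open>lambda_max S\<close>.
\<close>

lemma inner_le_lambda_max:
  fixes S :: "real^'n^'n"
  assumes "transpose S = S"
  shows "inner (S *v v) v \<le> lambda_max S * (norm v)\<^sup>2"
proof -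
  obtain c w where w: "w \<noteq> 0" "- (S *v w) = c *\<^sub>R w"
    and bound: "\<And>v. c * (norm v)\<^sup>2 \<le> inner (- (S *v v)) v"
  proof (rule Rayleigh_minimizer_is_eigenvector[where T = "\<lambda>v. - (S *v v)" and S = UNIV and z = 1])
    show "inner (- (S *v v)) w = inner v (- (S *v w))" for v w
      using inner_matrix_adjoint[of S v w] assms by simp
    show "(1::real^'n) \<noteq> 0" by (simp add: vec_eq_iff)
  qed (auto intro: linear_compose_neg)
  have "S *v w = (- c) *\<^sub>R w" using w(2) by (metis minus_minus scaleR_minus_left)
  then have "- c \<in> eigenvalues S" using w(1) by (auto simp: eigenvalues_def)
  then have "- c \<le> lambda_max S"
    unfolding lambda_max_def using finite_eigenvalues[OF assms] by simp
  then have "(- c) * (norm v)\<^sup>2 \<le> lambda_max S * (norm v)\<^sup>2"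
    by (rule mult_right_mono) simp
  then show ?thesis using bound[of v] by simp
qed

lemma lambda_max_nonneg:
  assumes "pos_semidef S"
  shows "0 \<le> lambda_max S"
proof -
  have "0 \<le> inner (S *v 1) 1"
    using assms by (simp add: pos_semidef_def inner_commute)
  also have "\<dots> \<le> lambda_max S * (norm (1::real^'a))\<^sup>2"
    using assms by (intro inner_le_lambda_max) (simp add: pos_semidef_def)
  finally show ?thesis
    by (simp add: zero_le_mult_iff vec_eq_iff)
qed

text \<open>
  Cauchy-Schwarz for the form of \<open>S\<close>, applied to \<open>v\<close> and \<open>S v\<close>. This turns a bound in terms of the
  seminorm given by \<open>S\<close> into a bound on the vector \<open>S v\<close> without square roots of matrices.
\<close>

lemma norm_psd_le_form:
  fixes S :: "real^'n^'n"
  assumes S: "pos_semidef S"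
  shows "(norm (S *v v))\<^sup>2 \<le> lambda_max S * inner (S *v v) v"
proof (cases "S *v v = 0")
  case False
  let ?q = "(norm (S *v v))\<^sup>2"
  have sym: "transpose S = S" and psd: "\<And>v. 0 \<le> inner (S *v v) v"
    using S by (auto simp: pos_semidef_def inner_commute)
  have "?q * ?q = (inner (S *v v) (S *v v))\<^sup>2"
    by (simp only: power2_norm_eq_inner power2_eq_square[of "inner _ _"])
  also have "\<dots> \<le> inner (S *v v) v * inner (S *v (S *v v)) (S *v v)"
  proof (rule psd_Cauchy_Schwarz[where T = "(*v) S" and S = UNIV])
    show "inner (S *v v) w = inner v (S *v w)" for v w
      using inner_matrix_adjoint[of S v w] by (simp only: sym)
  qed (use psd in simp_all)
  also have "\<dots> \<le> inner (S *v v) v * (lambda_max S * ?q)"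
    by (intro mult_left_mono inner_le_lambda_max sym psd)
  finally have "?q * ?q \<le> (lambda_max S * inner (S *v v) v) * ?q"
    by (simp only: mult_ac)
  then show ?thesis by (rule mult_right_le_imp_le) (use False in simp)
qed (simp add: lambda_max_nonneg[OF S])

lemma norm_psd_le:
  fixes S :: "real^'n^'n"
  assumes S: "pos_semidef S"
  shows "norm (S *v v) \<le> lambda_max S * norm v"
proof -
  have "(norm (S *v v))\<^sup>2 \<le> lambda_max S * inner (S *v v) v"
    using S by (rule norm_psd_le_form)
  also have "\<dots> \<le> lambda_max S * (lambda_max S * (norm v)\<^sup>2)"
    using S lambda_max_nonneg[OF S]
    by (intro mult_left_mono inner_le_lambda_max) (simp_all add: pos_semidef_def)
  also have "\<dots> = (lambda_max S * norm v)\<^sup>2"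
    by (simp only: power2_eq_square mult_ac)
  finally show ?thesis
    by (rule power2_le_imp_le) (simp add: lambda_max_nonneg[OF S])
qed

text \<open>
  The operators \<open>A A\<^sup>T\<close> and \<open>A\<^sup>T A\<close> have the same non-zero eigenvalues: \<open>A\<^sup>T\<close> maps eigenvectors of the
  first to eigenvectors of the second. On the column space of \<open>A\<close>, which is orthogonal to the kernel
  of \<open>A\<^sup>T\<close>, the least eigenvalue of \<open>A A\<^sup>T\<close> is non-zero, so \<open>lambda_min_nz (A\<^sup>T A)\<close> bounds it from
  below.
\<close>

lemma lambda_min_nz_le_on_column_space:
  fixes A :: "real^'n^'m"
  assumes "a \<in> span (columns A)"
  shows "lambda_min_nz (transpose A ** A) * (norm a)\<^sup>2 \<le> (norm (transpose A *v a))\<^sup>2"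
proof (cases "a = 0")
  case False
  let ?T = "\<lambda>v. A *v (transpose A *v v)"
  obtain c v where v: "v \<in> span (columns A)" "v \<noteq> 0" "?T v = c *\<^sub>R v"
    and bound: "\<And>w. w \<in> span (columns A) \<Longrightarrow> c * (norm w)\<^sup>2 \<le> inner (?T w) w"
  proof (rule Rayleigh_minimizer_is_eigenvector[where T = ?T and S = "span (columns A)" and z = a])
    show "linear ?T"
      using linear_compose[of "(*v) (transpose A)" "(*v) A"]
      by (simp add: o_def del: transpose_matrix_vector)
    show "inner (?T v) w = inner v (?T w)" for v w
      by (simp only: inner_matrix_adjoint transpose_transpose)
  qed (use assms False in \<open>auto simp: matrix_vector_mult_in_columnspace\<close>)
  have ATv: "transpose A *v v \<noteq> 0"
  proof
    assume "transpose A *v v = 0"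
    moreover have "v \<in> span (rows (transpose A))" using v by simp
    ultimately have "orthogonal v v" by (rule orthogonal_nullspace_rowspace)
    then show False using v(2) by (simp add: orthogonal_self)
  qed
  have "(transpose A ** A) *v (transpose A *v v) = c *\<^sub>R (transpose A *v v)"
    by (simp only: matrix_vector_mul_assoc[symmetric] v(3) matrix_vector_mult_scaleR)
  then have "c \<in> eigenvalues (transpose A ** A)"
    using ATv by (auto simp: eigenvalues_def)
  moreover have "c \<noteq> 0"
  proof
    assume "c = 0"
    then have "inner (?T v) v = 0" using v(3) by simp
    then show False
      using ATv inner_matrix_adjoint[of A "transpose A *v v" v] by simp
  qed
  moreover have "finite (eigenvalues (transpose A ** A))"
    using pos_semidef_gram[of A] by (intro finite_eigenvalues) (simp add: pos_semidef_def)
  ultimately have "lambda_min_nz (transpose A ** A) \<le> c"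
    unfolding lambda_min_nz_def by simp
  then have "lambda_min_nz (transpose A ** A) * (norm a)\<^sup>2 \<le> c * (norm a)\<^sup>2"
    by (rule mult_right_mono) simp
  also have "\<dots> \<le> inner (?T a) a" using assms by (rule bound)
  also have "\<dots> = (norm (transpose A *v a))\<^sup>2"
    by (simp only: inner_matrix_adjoint power2_norm_eq_inner)
  finally show ?thesis .
qed simp

section \<open>Gradients\<close>

lemma grad_eqI:
  assumes "GDERIV f x :> d"
  shows "grad f x = d"
  unfolding grad_def
proof (rule the_equality)
  fix e
  assume "GDERIV f x :> e"
  with assms have "(\<lambda>h. inner h d) = (\<lambda>h. inner h e)"
    unfolding gderiv_def by (rule has_derivative_unique)
  then show "e = d" by (metis vector_eq_ldot)
qed (fact assms)

text \<open>
  On a Euclidean space every linear functional is an inner product with the image of \<open>1\<close> under its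
  adjoint.
\<close>

lemma GDERIV_grad:
  fixes f :: "'a::euclidean_space \<Rightarrow> real"
  assumes "f differentiable (at x)"
  shows "GDERIV f x :> grad f x"
proof -
  obtain f' where f': "(f has_derivative f') (at x)"
    using assms by (auto simp: differentiable_def)
  then have "linear f'" by (rule has_derivative_linear)
  then have "f' = (\<lambda>h. inner h (adjoint f' 1))"
    using adjoint_works[of f' _ 1] by auto
  then have "GDERIV f x :> adjoint f' 1"
    using f' unfolding gderiv_def by metis
  then show ?thesis by (metis grad_eqI)
qed

lemma linear_block: "linear (\<lambda>y. block y i)"
  by (auto simp: linear_iff block_def vec_eq_iff)

lemma inner_block: "inner v w = (\<Sum>i\<in>UNIV. inner (block v i) (block w i))"
  by (simp add: inner_vec_def block_def sum.cartesian_product UNIV_Times_UNIV[symmetric]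
      case_prod_unfold del: UNIV_Times_UNIV)

lemma norm_block: "(norm v)\<^sup>2 = (\<Sum>i\<in>UNIV. (norm (block v i))\<^sup>2)"
  by (simp add: power2_norm_eq_inner inner_block)

text \<open>
  The gradient of \<open>\<lambda>y. \<Sum>i\<in>UNIV. fi i (block y i)\<close>, as \<open>GDERIV_separable\<close> shows.
\<close>

definition separable_grad ::
    "('n::finite \<Rightarrow> real^'p \<Rightarrow> real) \<Rightarrow> real^('n \<times> 'p::finite) \<Rightarrow> real^('n \<times> 'p)" where
  "separable_grad fi x = (\<chi> r. grad (fi (fst r)) (block x (fst r)) $ snd r)"

lemma block_separable_grad: "block (separable_grad fi x) i = grad (fi i) (block x i)"
  by (simp add: block_def separable_grad_def vec_eq_iff)

lemma GDERIV_separable: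
  assumes "\<And>i. fi i differentiable_on UNIV"
  shows "GDERIV (\<lambda>y. \<Sum>i\<in>UNIV. fi i (block y i)) x :> separable_grad fi x"
proof -
  have "((\<lambda>y. fi i (block y i)) has_derivative (\<lambda>h. inner (block h i) (grad (fi i) (block x i))))
      (at x)" for i
  proof (rule has_derivative_compose[where g = "fi i"])
    show "((\<lambda>y. block y i) has_derivative (\<lambda>h. block h i)) (at x)"
      using linear_block by (rule linear_imp_has_derivative)
    show "(fi i has_derivative (\<lambda>h. inner h (grad (fi i) (block x i)))) (at (block x i))"
      using GDERIV_grad assms by (auto simp: differentiable_on_def gderiv_def)
  qed
  then show ?thesis
    unfolding gderiv_def inner_block block_separable_grad
    by (intro has_derivative_sum)
qed

text \<open>
  The blocks do not interact, so squared norms add up and the worst modulus works for all of them.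
\<close>

lemma separable_grad_Lipschitz:
  assumes "\<And>i. (Li i)-lipschitz_on UNIV (grad (fi i))"
  shows "norm (separable_grad fi x - separable_grad fi y) \<le> Max (range Li) * norm (x - y)"
proof -
  have Li: "0 \<le> Li i" "Li i \<le> Max (range Li)" for i
    using lipschitz_on_nonneg[OF assms] by auto
  have "(norm (separable_grad fi x - separable_grad fi y))\<^sup>2
      = (\<Sum>i\<in>UNIV. (norm (grad (fi i) (block x i) - grad (fi i) (block y i)))\<^sup>2)"
    by (simp add: norm_block block_separable_grad linear_diff[OF linear_block])
  also have "\<dots> \<le> (\<Sum>i\<in>UNIV. (Max (range Li) * norm (block x i - block y i))\<^sup>2)"
  proof (intro sum_mono power_mono)
    fix i
    have "norm (grad (fi i) (block x i) - grad (fi i) (block y i))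
        \<le> Li i * norm (block x i - block y i)"
      using lipschitz_onD[OF assms, of "block x i" "block y i" i] by (simp add: dist_norm)
    also have "\<dots> \<le> Max (range Li) * norm (block x i - block y i)"
      using Li by (intro mult_right_mono) auto
    finally show "norm (grad (fi i) (block x i) - grad (fi i) (block y i)) \<le> \<dots>" .
  qed simp
  also have "\<dots> = (Max (range Li) * norm (x - y))\<^sup>2"
    by (simp add: power_mult_distrib norm_block linear_diff[OF linear_block] flip: sum_distrib_left)
  finally have "(norm (separable_grad fi x - separable_grad fi y))\<^sup>2
      \<le> (Max (range Li) * norm (x - y))\<^sup>2" .
  moreover have "0 \<le> Max (range Li) * norm (x - y)"
    using order_trans[OF Li] by (intro mult_nonneg_nonneg) auto
  ultimately show ?thesis by (rule power2_le_imp_le)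
qed

lemma GDERIV_linear_form: "GDERIV (\<lambda>y. inner a y) x :> a"
  unfolding gderiv_def inner_commute[of a]
  by (intro bounded_linear_imp_has_derivative bounded_linear_inner_left)

lemma GDERIV_cmult: "GDERIV f x :> d \<Longrightarrow> GDERIV (\<lambda>y. c * f y) x :> c *\<^sub>R d"
  unfolding gderiv_def inner_scaleR_right by (rule has_derivative_mult_right)

lemma GDERIV_sqnorm:
  assumes "transpose S = S"
  shows "GDERIV (\<lambda>y. sqnorm S (y - c)) x :> 2 *\<^sub>R (S *v (x - c))"
proof -
  have shift: "((\<lambda>y. y - c) has_derivative (\<lambda>h. h)) (at x)"
    by (auto intro!: derivative_eq_intros)
  have "((\<lambda>y. S *v (y - c)) has_derivative (\<lambda>h. S *v h)) (at x)"
    by (rule bounded_linear.has_derivative[OF matrix_vector_mul_bounded_linear shift])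
  with shift have "((\<lambda>y. inner (y - c) (S *v (y - c))) has_derivative
      (\<lambda>h. inner (x - c) (S *v h) + inner h (S *v (x - c)))) (at x)"
    by (rule has_derivative_inner)
  moreover have "inner (x - c) (S *v h) = inner h (S *v (x - c))" for h
    using inner_matrix_adjoint[of S "x - c" h] assms by (simp add: inner_commute)
  ultimately show ?thesis
    by (simp add: gderiv_def sqnorm_def)
qed

lemma GDERIV_zero_at_minimum:
  assumes "GDERIV f x :> d" and "is_arg_min f (\<lambda>_. True) x"
  shows "d = 0"
proof -
  have "(\<lambda>h. inner h d) = (\<lambda>_. 0)"
    using assms by (intro differential_zero_maxmin[where S = UNIV and f = f and x = x])
      (auto simp: gderiv_def is_arg_min_linorder)
  then show ?thesis by (metis inner_eq_zero_iff)
qed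

section \<open>Contraction of a proximal primal-dual step\<close>

text \<open>
  One step of a proximal primal-dual method, written in terms of errors: \<open>a\<close> and \<open>y\<close> are the dual and
  primal errors before the step, \<open>a'\<close> and \<open>y'\<close> those after it, \<open>d\<close> is the difference between the
  gradients at the new point and at the optimum, and \<open>c\<close> is the dual step size. The energy balance
  says that the weighted squared error drops by
  \<open>(norm (a' - a))\<^sup>2 / c + sqnorm M (y' - y) + 2 * inner d y'\<close>. Of this, \<open>sqnorm M (y' - y)\<close> and the
  monotonicity term are enough to pay for \<open>\<delta>\<close> times the new error: the bound \<open>\<delta>_prox\<close> makes the
  first cover the part of the dual error caused by \<open>M *v (y' - y)\<close>, and \<open>\<delta>_grad\<close> makes the
  second cover the part caused by \<open>d\<close> together with the primal error.
\<close>

lemma proximal_primal_dual_contraction: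
  fixes E :: "real^'n^'m" and M :: "real^'n^'n"
  assumes M: "pos_semidef M" and c: "c > 0"
    and stationary: "d + transpose E *v a' + M *v (y' - y) = 0"
    and ascent: "a' - a = c *\<^sub>R (E *v y')"
    and monotone: "\<mu> * (norm y')\<^sup>2 \<le> inner d y'"
    and Lipschitz: "norm d \<le> Lg * norm y'"
    and column_space: "a' \<in> span (columns E)"
    and \<tau>: "\<tau> > 0" and \<delta>: "\<delta> > 0"
    and \<delta>_prox: "\<delta> \<le> c * lambda_min_nz (transpose E ** E) / ((1 + 1 / \<tau>) * lambda_max M)"
    and \<delta>_grad: "\<delta> \<le> 2 * c * \<mu> * lambda_min_nz (transpose E ** E)
        / ((1 + \<tau>) * Lg\<^sup>2 + 2 * c * lambda_max M * lambda_min_nz (transpose E ** E))"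
  shows "(1 + \<delta>) * ((norm a')\<^sup>2 / c + sqnorm M y') \<le> (norm a)\<^sup>2 / c + sqnorm M y"
proof -
  define w where "w = y' - y"
  define \<Lambda> l where "\<Lambda> = lambda_max M" and "l = lambda_min_nz (transpose E ** E)"
  define Y q where "Y = (norm y')\<^sup>2" and "q = sqnorm M w"
  have M_sym: "inner (M *v v) z = inner v (M *v z)" for v z
    using M inner_matrix_adjoint[of M v z] by (simp add: pos_semidef_def)
  have Y: "0 \<le> Y" by (simp add: Y_def)
  have q: "0 \<le> q" using M by (simp add: pos_semidef_def sqnorm_def q_def)

  have "(norm a)\<^sup>2 = (norm a')\<^sup>2 + (norm (a' - a))\<^sup>2 - 2 * inner a' (a' - a)"
    by (simp add: power2_norm_eq_inner inner_diff_left inner_diff_right inner_commute)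
  moreover have "sqnorm M y = sqnorm M y' + q - 2 * inner (M *v w) y'"
    using M_sym by (simp add: sqnorm_def q_def w_def inner_diff_left inner_diff_right
        matrix_vector_mult_diff_distrib inner_commute)
  moreover have "inner a' (a' - a) = c * inner (transpose E *v a') y'"
    using ascent inner_matrix_adjoint[of E y' a'] by (simp add: inner_commute)
  ultimately have "(norm a)\<^sup>2 / c + sqnorm M y
      = (norm a')\<^sup>2 / c + sqnorm M y' + (norm (a' - a))\<^sup>2 / c + q
        - 2 * (inner (transpose E *v a') y' + inner (M *v w) y')"
    using c by (simp add: add_divide_distrib diff_divide_distrib)
  moreover have "inner (transpose E *v a') y' + inner (M *v w) y' = - inner d y'"
    using arg_cong[OF stationary, of "\<lambda>v. inner v y'"] unfolding w_def inner_add_left by simp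
  ultimately have energy: "(norm a)\<^sup>2 / c + sqnorm M y
      = (norm a')\<^sup>2 / c + sqnorm M y' + (norm (a' - a))\<^sup>2 / c + q + 2 * inner d y'"
    by simp

  \<comment> \<open>Division by zero gives zero, so the first bound on the positive \<open>\<delta>\<close> excludes \<open>\<Lambda> = 0\<close>.\<close>
  have prox_pos: "0 < c * l / ((1 + 1 / \<tau>) * \<Lambda>)"
    using \<delta> \<delta>_prox by (simp add: \<Lambda>_def l_def)
  then have "\<Lambda> \<noteq> 0" by auto
  then have \<Lambda>: "\<Lambda> > 0" using lambda_max_nonneg[OF M] by (simp add: \<Lambda>_def)
  then have denominator: "0 < (1 + 1 / \<tau>) * \<Lambda>"
    using \<tau> by (intro mult_pos_pos add_pos_pos) auto
  then have l: "l > 0"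
    using prox_pos c zero_less_divide_iff zero_less_mult_pos by (metis less_asym)
  have 1: "\<delta> * ((1 + 1 / \<tau>) * \<Lambda>) \<le> c * l"
    using \<delta>_prox denominator unfolding \<Lambda>_def[symmetric] l_def[symmetric]
    by (simp only: pos_le_divide_eq)
  \<comment> \<open>The shape in which \<open>\<delta>\<close> meets the coefficient of \<open>Y\<close> in the final estimate.\<close>
  have "\<delta> * ((1 + \<tau>) * Lg\<^sup>2 + c * \<Lambda> * l) \<le> \<delta> * ((1 + \<tau>) * Lg\<^sup>2 + 2 * c * \<Lambda> * l)"
    using \<delta> \<Lambda> l c by (intro mult_left_mono add_left_mono mult_right_mono) auto
  moreover have "0 < (1 + \<tau>) * Lg\<^sup>2 + 2 * c * \<Lambda> * l"
    using \<tau> c \<Lambda> l by (intro add_nonneg_pos) auto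
  then have "\<delta> * ((1 + \<tau>) * Lg\<^sup>2 + 2 * c * \<Lambda> * l) \<le> 2 * c * \<mu> * l"
    using \<delta>_grad unfolding \<Lambda>_def[symmetric] l_def[symmetric]
    by (simp only: pos_le_divide_eq)
  ultimately have 2: "\<delta> * ((1 + \<tau>) * Lg\<^sup>2 + c * \<Lambda> * l) \<le> 2 * c * \<mu> * l"
    by simp

  have Young: "(norm (d + M *v w))\<^sup>2 \<le> (1 + \<tau>) * (norm d)\<^sup>2 + (1 + 1 / \<tau>) * (norm (M *v w))\<^sup>2"
  proof -
    let ?e = "M *v w"
    have "(norm (\<tau> *\<^sub>R d - ?e))\<^sup>2 = \<tau> * (\<tau> * (norm d)\<^sup>2) + (norm ?e)\<^sup>2 - \<tau> * (2 * inner d ?e)"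
      unfolding power2_norm_eq_inner
      by (simp add: inner_diff_left inner_diff_right inner_commute)
    then have "0 \<le> \<tau> * (\<tau> * (norm d)\<^sup>2) + (norm ?e)\<^sup>2 - \<tau> * (2 * inner d ?e)"
      by (metis zero_le_power2)
    then have "\<tau> * (2 * inner d ?e) \<le> \<tau> * (\<tau> * (norm d)\<^sup>2 + (norm ?e)\<^sup>2 / \<tau>)"
      using \<tau> by (simp add: distrib_left)
    then have "2 * inner d ?e \<le> \<tau> * (norm d)\<^sup>2 + (norm ?e)\<^sup>2 / \<tau>"
      using \<tau> by (simp only: mult_le_cancel_left_pos)
    moreover have "(norm (d + ?e))\<^sup>2 = (norm d)\<^sup>2 + (norm ?e)\<^sup>2 + 2 * inner d ?e"
      unfolding power2_norm_eq_inner
      by (simp add: inner_add_left inner_add_right inner_commute)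
    ultimately show ?thesis
      by (simp add: distrib_right)
  qed
  have "l * (norm a')\<^sup>2 \<le> (norm (transpose E *v a'))\<^sup>2"
    unfolding l_def using column_space by (rule lambda_min_nz_le_on_column_space)
  also have "transpose E *v a' = - (d + M *v w)"
    using stationary by (simp only: w_def eq_neg_iff_add_eq_0 add_ac)
  also have "(norm \<dots>)\<^sup>2 = (norm (d + M *v w))\<^sup>2" by (simp only: norm_minus_cancel)
  also note Young
  also have "(1 + \<tau>) * (norm d)\<^sup>2 + (1 + 1 / \<tau>) * (norm (M *v w))\<^sup>2
      \<le> (1 + \<tau>) * (Lg\<^sup>2 * Y) + (1 + 1 / \<tau>) * (\<Lambda> * q)"
  proof (intro add_mono mult_left_mono)
    show "(norm d)\<^sup>2 \<le> Lg\<^sup>2 * Y"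
      using power_mono[OF Lipschitz, of 2] by (simp add: Y_def power_mult_distrib)
    show "(norm (M *v w))\<^sup>2 \<le> \<Lambda> * q"
      using norm_psd_le_form[OF M, of w] by (simp add: \<Lambda>_def q_def sqnorm_def inner_commute)
  qed (use \<tau> in auto)
  finally have dual: "l * (norm a')\<^sup>2 \<le> (1 + \<tau>) * (Lg\<^sup>2 * Y) + (1 + 1 / \<tau>) * (\<Lambda> * q)" .
  have primal: "sqnorm M y' \<le> \<Lambda> * Y"
    using inner_le_lambda_max[of M y'] M
    by (simp add: sqnorm_def \<Lambda>_def Y_def pos_semidef_def inner_commute)

  \<comment> \<open>Multiplying by \<open>c * l\<close> clears all denominators.\<close>
  have "c * l * (\<delta> * ((norm a')\<^sup>2 / c + sqnorm M y'))
      = \<delta> * (l * (norm a')\<^sup>2 + c * l * sqnorm M y')"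
    using c by (simp add: field_simps)
  also have "\<dots> \<le> \<delta> * (((1 + \<tau>) * (Lg\<^sup>2 * Y) + (1 + 1 / \<tau>) * (\<Lambda> * q)) + c * l * (\<Lambda> * Y))"
    using \<delta> c l dual primal by (intro mult_left_mono add_mono) auto
  also have "\<dots> = \<delta> * ((1 + \<tau>) * Lg\<^sup>2 + c * \<Lambda> * l) * Y + \<delta> * ((1 + 1 / \<tau>) * \<Lambda>) * q"
    by (simp add: algebra_simps)
  also have "\<dots> \<le> 2 * c * \<mu> * l * Y + c * l * q"
    using 1 2 Y q by (intro add_mono mult_right_mono)
  also have "\<dots> = c * l * (2 * \<mu> * Y + q)"
    by (simp add: algebra_simps)
  finally have "\<delta> * ((norm a')\<^sup>2 / c + sqnorm M y') \<le> 2 * \<mu> * Y + q"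
    using c l by (simp add: mult_le_cancel_left)
  also have "\<dots> \<le> 2 * inner d y' + q" using monotone by (simp add: Y_def)
  also have "\<dots> \<le> (norm (a' - a))\<^sup>2 / c + q + 2 * inner d y'" using c by simp
  finally show ?thesis unfolding energy distrib_right mult_1_left by linarith
qed

section \<open>Stacked vectors and consensus\<close>

lemma sum_UNIV_sum_type:
  "(\<Sum>r\<in>UNIV. h r) = (\<Sum>i\<in>UNIV. h (Inl i)) + (\<Sum>j\<in>UNIV. h (Inr j))"
  for h :: "'a::finite + 'b::finite \<Rightarrow> 'c::comm_monoid_add"
  using sum.Plus[of UNIV UNIV h] by (simp add: o_def)

lemma sqnorm_block_diag_stack:
  "sqnorm (block_diag (c *\<^sub>R mat 1) M) (stack a b) = c * (norm a)\<^sup>2 + sqnorm M b"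
proof -
  let ?H = "block_diag (c *\<^sub>R mat 1) M"
  have "(?H *v stack a b) $ r = stack (c *\<^sub>R a) (M *v b) $ r" for r
  proof (cases r)
    case (Inl i)
    have "(?H *v stack a b) $ r = (\<Sum>j\<in>UNIV. (c *\<^sub>R mat 1) $ i $ j * a $ j)"
      by (simp add: Inl matrix_vector_mult_def block_diag_def stack_def sum_UNIV_sum_type)
    also have "\<dots> = ((c *\<^sub>R mat 1) *v a) $ i"
      by (simp add: matrix_vector_mult_def)
    also have "(c *\<^sub>R mat 1) *v a = c *\<^sub>R a"
      by (simp flip: scaleR_matrix_vector_assoc)
    finally show ?thesis by (simp add: Inl stack_def)
  qed (simp add: matrix_vector_mult_def block_diag_def stack_def sum_UNIV_sum_type)
  then have "?H *v stack a b = stack (c *\<^sub>R a) (M *v b)"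
    by (simp add: vec_eq_iff)
  moreover have "inner (stack a b) (stack v w) = inner a v + inner b w" for v w
    by (simp add: inner_vec_def stack_def sum_UNIV_sum_type)
  ultimately show ?thesis
    by (simp add: sqnorm_def power2_norm_eq_inner)
qed

lemma stack_diff: "stack a b - stack a' b' = stack (a - a') (b - b')"
  by (auto simp: stack_def vec_eq_iff split: sum.split)

text \<open>
  Source and destination matrices pick the same value from a vector with equal blocks; hence their
  difference annihilates consensus vectors.
\<close>

lemma arc_source_consensus:
  fixes lab :: "'m::finite \<Rightarrow> 'n::finite \<times> 'n" and v :: "real^'p::finite"
  shows "arc_source_matrix lab *v consensus v = (\<chi> r. v $ snd r)"
proof -
  have "(\<Sum>s\<in>UNIV. (if fst (lab (fst r)) = fst s \<and> snd r = snd s then 1 else 0) * v $ snd s)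
      = (\<Sum>s\<in>{(fst (lab (fst r)), snd r)}. v $ snd s)" for r :: "'m \<times> 'p"
    by (rule sum.mono_neutral_cong_right) (auto split: if_splits)
  then show ?thesis
    by (simp add: matrix_vector_mult_def arc_source_matrix_def consensus_def vec_eq_iff)
qed

lemma arc_destination_consensus:
  fixes lab :: "'m::finite \<Rightarrow> 'n::finite \<times> 'n" and v :: "real^'p::finite"
  shows "arc_destination_matrix lab *v consensus v = (\<chi> r. v $ snd r)"
proof -
  have "arc_destination_matrix lab
      = (arc_source_matrix (\<lambda>a. prod.swap (lab a)) :: real^('n \<times> 'p)^('m \<times> 'p))"
    by (simp add: arc_source_matrix_def arc_destination_matrix_def)
  then show ?thesis by (simp only: arc_source_consensus)
qed

section \<open>Linear convergence of generalized D-ADMM\<close>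

theorem theorem1:
  fixes \<A> :: "('n::finite \<times> 'n) set"
    and lab :: "'m::finite \<Rightarrow> 'n \<times> 'n"
    and A\<^sub>s A\<^sub>d E\<^sub>o E\<^sub>u :: "real^('n \<times> 'p::finite)^('m \<times> 'p)"
    and D P M :: "real^('n \<times> 'p)^('n \<times> 'p)"
    and Q :: "real^'n^'n"
    and H :: "real^(('m \<times> 'p) + ('n \<times> 'p))^(('m \<times> 'p) + ('n \<times> 'p))"
    and fi :: "'n \<Rightarrow> real^'p \<Rightarrow> real"
    and fbar :: "real^'p \<Rightarrow> real"
    and f g :: "real^('n \<times> 'p) \<Rightarrow> real"
    and Li :: "'n \<Rightarrow> real"
    and L L\<^sub>g \<mu>\<^sub>f \<mu>\<^sub>g \<rho> \<eta> \<delta> :: real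
    and xbar :: "real^'p"
    and xstar :: "real^('n \<times> 'p)"
    and \<alpha>star :: "real^('m \<times> 'p)"
    and x :: "nat \<Rightarrow> real^('n \<times> 'p)"
    and \<alpha> :: "nat \<Rightarrow> real^('m \<times> 'p)"
    and u :: "nat \<Rightarrow> real^(('m \<times> 'p) + ('n \<times> 'p))"
    and ustar :: "real^(('m \<times> 'p) + ('n \<times> 'p))"
  \<comment> \<open>network\<close>
  assumes "CARD('n) \<ge> 2"
    and "connected_network \<A>"
    and "bij_betw lab UNIV \<A>"
    and "A\<^sub>s = arc_source_matrix lab"
    and "A\<^sub>d = arc_destination_matrix lab"
    and "E\<^sub>o = A\<^sub>s - A\<^sub>d"
    and "E\<^sub>u = A\<^sub>s + A\<^sub>d"
    and "D = (1/2) *\<^sub>R (transpose E\<^sub>o ** E\<^sub>o + transpose E\<^sub>u ** E\<^sub>u)"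
  \<comment> \<open>objective functions\<close>
    and "\<And>i. convex_on UNIV (fi i)"
    and "\<And>i. fi i differentiable_on UNIV"
    and "\<And>i. (Li i)-lipschitz_on UNIV (grad (fi i))"
    and "L = Max (range Li)"
    and "fbar = (\<lambda>y. \<Sum>i\<in>UNIV. fi i y)"
    and "\<mu>\<^sub>f > 0"
    and "strongly_convex_with \<mu>\<^sub>f fbar"
    and "f = (\<lambda>y. \<Sum>i\<in>UNIV. fi i (block y i))"
  \<comment> \<open>parameters and derived constants\<close>
    and "\<rho> > 0"
    and "0 < \<eta>" "\<eta> < 1"
    and "diagonal_matrix Q"
    and "P = kronecker Q (mat 1)"
    and "pos_semidef P"
    and "M = (\<rho>/2) *\<^sub>R (2 *\<^sub>R D + (2/\<rho>) *\<^sub>R P - transpose E\<^sub>o ** E\<^sub>o)"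
    and "H = block_diag ((2 / (\<rho> * \<eta>)) *\<^sub>R mat 1) M"
    and "g = (\<lambda>y. f y + \<rho> * (1 - \<eta>) / 4 * (norm (E\<^sub>o *v y))\<^sup>2)"
    and "L\<^sub>g = L + (1 - \<eta>) * \<rho> / 2 * lambda_max (transpose E\<^sub>o ** E\<^sub>o)"
  \<comment> \<open>optimal primal and dual points\<close>
    and "is_arg_min fbar (\<lambda>_. True) xbar"
    and "xstar = consensus xbar"
    and "\<alpha>star \<in> span (columns E\<^sub>o)"
    and "grad f xstar + transpose E\<^sub>o *v \<alpha>star = 0"
    and "\<mu>\<^sub>g > 0"
    and "restricted_strongly_convex_with \<mu>\<^sub>g g xstar"
  \<comment> \<open>iterates\<close>
    and "\<alpha> 0 \<in> span (columns E\<^sub>o)"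
    and "\<And>k. is_arg_min
            (\<lambda>y. f y
               + inner (transpose E\<^sub>o *v \<alpha> k - (\<rho>/2) *\<^sub>R ((transpose E\<^sub>u ** E\<^sub>u) *v x k)) y
               + \<rho>/2 * sqnorm D y + 1/2 * sqnorm P (y - x k))
            (\<lambda>_. True) (x (Suc k))"
    and "\<And>k. \<alpha> (Suc k) = \<alpha> k + (\<eta> * \<rho> / 2) *\<^sub>R (E\<^sub>o *v x (Suc k))"
    and "\<And>k. u k = stack (\<alpha> k) (x k)"
    and "ustar = stack \<alpha>star xstar"
  \<comment> \<open>rate; the supremum over \<open>\<tau> > 0\<close> is attained, i.e. it is the maximum\<close>
    and "\<delta> > 0"
    and "\<delta> \<le> (SUP \<tau>\<in>{0<..}. min
            (\<rho> * \<eta> * lambda_min_nz (transpose E\<^sub>o ** E\<^sub>o) / (2 * (1 + 1/\<tau>) * lambda_max M))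
            (\<rho> * \<eta> * \<mu>\<^sub>g * lambda_min_nz (transpose E\<^sub>o ** E\<^sub>o)
              / ((1 + \<tau>) * L\<^sub>g\<^sup>2 + \<rho> * \<eta> * lambda_max M * lambda_min_nz (transpose E\<^sub>o ** E\<^sub>o))))"
  shows "\<forall>k. sqnorm H (u (Suc k) - ustar) \<le> 1 / (1 + \<delta>) * sqnorm H (u k - ustar)"
proof
  fix k
  note differentiable = assms(10) and lipschitz = assms(11)
    and primal_update = assms(34) and dual_update = assms(35) and u = assms(36)
  note [simp del] = transpose_matrix_vector
  define G where "G = transpose E\<^sub>o ** E\<^sub>o"
  define U where "U = transpose E\<^sub>u ** E\<^sub>u"
  define gradf where "gradf = separable_grad fi"
  \<comment> \<open>The dual step size; the weight of the dual variables in \<open>H\<close> is \<open>1 / c\<close>.\<close>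
  define c where "c = \<rho> * \<eta> / 2"
  have sym: "transpose P = P" "transpose G = G" "transpose U = U"
    using \<open>pos_semidef P\<close> pos_semidef_gram[of E\<^sub>o] pos_semidef_gram[of E\<^sub>u]
    unfolding pos_semidef_def G_def U_def by blast+
  have D: "D = (1/2) *\<^sub>R (G + U)"
    using \<open>D = _\<close> by (simp add: G_def U_def)
  have M: "M = (\<rho>/2) *\<^sub>R U + P"
  proof -
    have "(\<rho>/2) *\<^sub>R ((2/\<rho>) *\<^sub>R P) = P" using \<open>\<rho> > 0\<close> by simp
    then show ?thesis
      using \<open>M = _\<close> by (simp add: D algebra_simps flip: G_def)
  qed
  have M_psd: "pos_semidef M"
    unfolding pos_semidef_def
  proof (intro conjI allI)
    show "transpose M = M"
      using sym by (simp add: M transpose_scalar transpose_def vec_eq_iff)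
    fix v
    have "inner v (M *v v) = \<rho>/2 * inner v (U *v v) + inner v (P *v v)"
      by (simp add: M matrix_vector_mult_add_rdistrib inner_add_right
          flip: scaleR_matrix_vector_assoc)
    moreover have "0 \<le> inner v (U *v v)" "0 \<le> inner v (P *v v)"
      using pos_semidef_gram[of E\<^sub>u] \<open>pos_semidef P\<close> unfolding pos_semidef_def U_def by blast+
    ultimately show "0 \<le> inner v (M *v v)"
      using \<open>\<rho> > 0\<close> by simp
  qed

  have grad_f: "GDERIV f y :> gradf y" for y
    unfolding \<open>f = _\<close> gradf_def using differentiable by (rule GDERIV_separable)
  have sqnorm_sym: "GDERIV (\<lambda>y. b * sqnorm S (y - z)) y :> (2 * b) *\<^sub>R (S *v (y - z))"
    if "transpose S = S" for b y z and S :: "real^('n \<times> 'p)^('n \<times> 'p)"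
    using GDERIV_cmult[OF GDERIV_sqnorm[OF that], of b z y] by (simp add: mult.commute)
  have grad_g: "grad g y = gradf y + (\<rho> * (1 - \<eta>) / 2) *\<^sub>R (G *v y)" for y
  proof (rule grad_eqI)
    have "g = (\<lambda>y. f y + \<rho> * (1 - \<eta>) / 4 * sqnorm G (y - 0))"
      unfolding \<open>g = _\<close> by (simp add: sqnorm_def G_def inner_gram inner_commute[of _ "_ *v _"])
    then show "GDERIV g y :> gradf y + (\<rho> * (1 - \<eta>) / 2) *\<^sub>R (G *v y)"
      using GDERIV_add[OF grad_f sqnorm_sym[OF sym(2), of "\<rho> * (1 - \<eta>) / 4" 0 y]] by simp
  qed

  have E_consensus: "E\<^sub>o *v xstar = 0"
    using \<open>E\<^sub>o = _\<close> \<open>A\<^sub>s = _\<close> \<open>A\<^sub>d = _\<close> \<open>xstar = _\<close>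
    by (simp add: matrix_vector_mult_diff_rdistrib arc_source_consensus arc_destination_consensus)
  then have G_consensus: "G *v xstar = 0"
    by (simp add: G_def flip: matrix_vector_mul_assoc)
  have dual_step: "\<alpha> (Suc k) - \<alpha> k = c *\<^sub>R (E\<^sub>o *v x (Suc k))" for k
    using dual_update[of k] by (simp add: c_def mult.commute)
  have column_space: "\<alpha> k \<in> span (columns E\<^sub>o)" for k
    by (induction k) (use assms(33) dual_update in
        \<open>auto intro: span_add span_scale matrix_vector_mult_in_columnspace\<close>)

  let ?a = "\<lambda>k. \<alpha> k - \<alpha>star" and ?y = "\<lambda>k. x k - xstar"
  let ?d = "grad g (x (Suc k)) - grad g xstar"

  \<comment> \<open>First-order condition of the primal update, still in terms of \<open>\<alpha> k\<close>.\<close>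
  have optimality: "gradf (x (Suc k)) + (transpose E\<^sub>o *v \<alpha> k - (\<rho>/2) *\<^sub>R (U *v x k))
      + \<rho> *\<^sub>R (D *v x (Suc k)) + P *v (x (Suc k) - x k) = 0"
  proof (rule GDERIV_zero_at_minimum)
    have "transpose D = D"
      using sym by (simp add: D transpose_scalar transpose_def vec_eq_iff)
    then show "GDERIV (\<lambda>y. f y + inner (transpose E\<^sub>o *v \<alpha> k - (\<rho>/2) *\<^sub>R (U *v x k)) y
        + \<rho>/2 * sqnorm D y + 1/2 * sqnorm P (y - x k)) (x (Suc k)) :>
        gradf (x (Suc k)) + (transpose E\<^sub>o *v \<alpha> k - (\<rho>/2) *\<^sub>R (U *v x k))
        + \<rho> *\<^sub>R (D *v x (Suc k)) + P *v (x (Suc k) - x k)"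
      using sqnorm_sym[of D "\<rho>/2" 0] sqnorm_sym[OF sym(1), of "1/2" "x k"]
      by (auto intro!: GDERIV_add GDERIV_linear_form grad_f)
    show "is_arg_min (\<lambda>y. f y + inner (transpose E\<^sub>o *v \<alpha> k - (\<rho>/2) *\<^sub>R (U *v x k)) y
        + \<rho>/2 * sqnorm D y + 1/2 * sqnorm P (y - x k)) (\<lambda>_. True) (x (Suc k))"
      unfolding U_def by (rule primal_update)
  qed
  \<comment> \<open>Passing to \<open>\<alpha> (Suc k)\<close> turns the gradient of \<open>f\<close> into that of \<open>g\<close>.\<close>
  have stationary: "?d + transpose E\<^sub>o *v ?a (Suc k) + M *v (?y (Suc k) - ?y k) = 0"
  proof -
    have "\<alpha> (Suc k) = \<alpha> k + c *\<^sub>R (E\<^sub>o *v x (Suc k))"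
      using dual_step[of k] by (simp add: algebra_simps)
    then have dual: "transpose E\<^sub>o *v \<alpha> (Suc k) = transpose E\<^sub>o *v \<alpha> k + c *\<^sub>R (G *v x (Suc k))"
      by (simp add: G_def matrix_vector_right_distrib matrix_vector_mult_scaleR
          flip: matrix_vector_mul_assoc)
    have dual_star: "transpose E\<^sub>o *v \<alpha>star = - gradf xstar"
      using \<open>grad f xstar + _ = 0\<close> grad_eqI[OF grad_f, of xstar]
      by (simp add: eq_neg_iff_add_eq_0 add.commute)
    have proximal: "M *v (?y (Suc k) - ?y k)
        = (\<rho>/2) *\<^sub>R (U *v x (Suc k)) - (\<rho>/2) *\<^sub>R (U *v x k) + P *v (x (Suc k) - x k)"
      by (simp add: M matrix_vector_mult_add_rdistrib matrix_vector_mult_diff_distrib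
          scaleR_diff_right flip: scaleR_matrix_vector_assoc)
    have penalty: "\<rho> *\<^sub>R (D *v x (Suc k)) = (\<rho>/2) *\<^sub>R (G *v x (Suc k)) + (\<rho>/2) *\<^sub>R (U *v x (Suc k))"
      by (simp add: D matrix_vector_mult_add_rdistrib scaleR_add_right flip: scaleR_matrix_vector_assoc)
    have gradient: "?d = gradf (x (Suc k)) - gradf xstar
        + ((\<rho>/2) *\<^sub>R (G *v x (Suc k)) - c *\<^sub>R (G *v x (Suc k)))"
    proof -
      have "\<rho> * (1 - \<eta>) / 2 = \<rho>/2 - c" by (simp add: c_def field_simps)
      then show ?thesis
        unfolding grad_g by (simp only: G_consensus) (simp add: scaleR_diff_left)
    qed
    have "?d + transpose E\<^sub>o *v ?a (Suc k) + M *v (?y (Suc k) - ?y k)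
        = gradf (x (Suc k)) + (transpose E\<^sub>o *v \<alpha> k - (\<rho>/2) *\<^sub>R (U *v x k))
          + \<rho> *\<^sub>R (D *v x (Suc k)) + P *v (x (Suc k) - x k)"
      unfolding gradient proximal penalty
        matrix_vector_mult_diff_distrib[of "transpose E\<^sub>o"] dual dual_star by simp
    then show ?thesis using optimality by simp
  qed
  have monotone: "\<mu>\<^sub>g * (norm (?y (Suc k)))\<^sup>2 \<le> inner ?d (?y (Suc k))"
    using \<open>restricted_strongly_convex_with \<mu>\<^sub>g g xstar\<close>
    by (simp add: restricted_strongly_convex_with_def)
  have Lipschitz: "norm ?d \<le> L\<^sub>g * norm (?y (Suc k))"
  proof -
    have "?d = (gradf (x (Suc k)) - gradf xstar) + (\<rho> * (1 - \<eta>) / 2) *\<^sub>R (G *v ?y (Suc k))"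
      by (simp add: grad_g matrix_vector_mult_diff_distrib scaleR_diff_right)
    also have "norm \<dots> \<le> L * norm (?y (Suc k))
        + (\<rho> * (1 - \<eta>) / 2) * (lambda_max G * norm (?y (Suc k)))"
    proof (intro norm_triangle_mono)
      show "norm (gradf (x (Suc k)) - gradf xstar) \<le> L * norm (?y (Suc k))"
        unfolding gradf_def \<open>L = _\<close> using lipschitz by (rule separable_grad_Lipschitz)
      show "norm ((\<rho> * (1 - \<eta>) / 2) *\<^sub>R (G *v ?y (Suc k)))
          \<le> (\<rho> * (1 - \<eta>) / 2) * (lambda_max G * norm (?y (Suc k)))"
        using norm_psd_le[OF pos_semidef_gram[of E\<^sub>o], of "?y (Suc k)"] \<open>\<rho> > 0\<close> \<open>\<eta> < 1\<close>
        by (simp add: G_def mult_left_mono)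
    qed
    also have "\<dots> = L\<^sub>g * norm (?y (Suc k))"
      unfolding \<open>L\<^sub>g = _\<close> G_def by (simp add: algebra_simps)
    finally show ?thesis .
  qed

  have c: "c > 0" using \<open>\<rho> > 0\<close> \<open>0 < \<eta>\<close> by (simp add: c_def)
  have ascent: "?a (Suc k) - ?a k = c *\<^sub>R (E\<^sub>o *v ?y (Suc k))"
    using dual_step[of k] E_consensus by (simp add: matrix_vector_mult_diff_distrib)
  have dual_error: "?a (Suc k) \<in> span (columns E\<^sub>o)"
    using column_space \<open>\<alpha>star \<in> _\<close> by (rule span_diff)
  \<comment> \<open>The squared distance to the optimum in the norm of \<open>H\<close>.\<close>
  define V where "V j = (norm (?a j))\<^sup>2 / c + sqnorm M (?y j)" for j
  define rate where "rate \<tau> = min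
      (\<rho> * \<eta> * lambda_min_nz G / (2 * (1 + 1/\<tau>) * lambda_max M))
      (\<rho> * \<eta> * \<mu>\<^sub>g * lambda_min_nz G
        / ((1 + \<tau>) * L\<^sub>g\<^sup>2 + \<rho> * \<eta> * lambda_max M * lambda_min_nz G))" for \<tau>
  have \<delta>_le: "\<delta> \<le> (SUP \<tau>\<in>{0<..}. rate \<tau>)"
    unfolding rate_def G_def by (rule assms(39))
  have contraction: "(1 + \<epsilon>) * V (Suc k) \<le> V k" if \<epsilon>: "0 < \<epsilon>" "\<epsilon> < \<delta>" for \<epsilon>
  proof -
    have "\<epsilon> < (SUP \<tau>\<in>{0<..}. rate \<tau>)"
      using \<epsilon>(2) \<delta>_le by (rule less_le_trans)
    then obtain r where "r \<in> rate ` {0<..}" "\<epsilon> < r"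
      by (rule less_cSupE) auto
    then obtain \<tau> where \<tau>: "\<tau> > 0" and "\<epsilon> < rate \<tau>" by auto
    then have primal: "\<epsilon> < \<rho> * \<eta> * lambda_min_nz G / (2 * (1 + 1/\<tau>) * lambda_max M)"
      and dual: "\<epsilon> < \<rho> * \<eta> * \<mu>\<^sub>g * lambda_min_nz G
          / ((1 + \<tau>) * L\<^sub>g\<^sup>2 + \<rho> * \<eta> * lambda_max M * lambda_min_nz G)"
      by (simp_all add: rate_def)
    have "\<epsilon> \<le> c * lambda_min_nz G / ((1 + 1/\<tau>) * lambda_max M)"
    proof -
      have "c * l / (b * m) = \<rho> * \<eta> * l / (2 * b * m)" for l b m :: real
        by (simp add: c_def)
      then show ?thesis using primal by (simp only: less_imp_le)
    qed
    moreover have "\<epsilon> \<le> 2 * c * \<mu>\<^sub>g * lambda_min_nz G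
        / ((1 + \<tau>) * L\<^sub>g\<^sup>2 + 2 * c * lambda_max M * lambda_min_nz G)"
      using dual by (simp add: c_def)
    ultimately show ?thesis
      unfolding V_def G_def
      by (rule proximal_primal_dual_contraction[OF M_psd c stationary ascent monotone Lipschitz
            dual_error \<tau> \<epsilon>(1)])
  qed
  have V_nonneg: "0 \<le> V (Suc k)"
    using c M_psd by (simp add: V_def pos_semidef_def sqnorm_def)
  \<comment> \<open>Let \<open>\<epsilon>\<close> tend to \<open>\<delta>\<close>.\<close>
  have "(1 + \<delta>) * V (Suc k) \<le> V k"
  proof (cases "V (Suc k) = 0")
    case True
    then show ?thesis using contraction[of "\<delta>/2"] \<open>\<delta> > 0\<close> by simp
  next
    case False
    with V_nonneg have pos: "V (Suc k) > 0" by simp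
    have "\<delta> \<le> V k / V (Suc k) - 1"
    proof (rule dense_le_bounded[OF \<open>\<delta> > 0\<close>])
      fix \<epsilon> assume "0 < \<epsilon>" "\<epsilon> < \<delta>"
      then show "\<epsilon> \<le> V k / V (Suc k) - 1"
        using contraction[of \<epsilon>] pos by (simp add: field_simps)
    qed
    then show ?thesis using pos by (simp add: field_simps)
  qed
  moreover have "sqnorm H (u j - ustar) = V j" for j
    using u[of j] \<open>ustar = _\<close> \<open>H = _\<close>
    by (simp add: stack_diff sqnorm_block_diag_stack V_def c_def)
  ultimately show "sqnorm H (u (Suc k) - ustar) \<le> 1 / (1 + \<delta>) * sqnorm H (u k - ustar)"
    using \<open>\<delta> > 0\<close> by (simp add: field_simps)
qed

end
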